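(* Let $\Psi=\Psi(s,t)$ be a solution of the Betchov-Da Rios equation $\Psi_t=\Psi_s\times\Psi_{ss}\times\Psi_{sss}$ in $E^4$ (with unit speed $s$-parameter curves), with its parallel transport frame field. The soliton surface $\Psi=\Psi(s,t)$ is minimal if and only if the equations $\mathcal{B}=0$ and $Q^2\mathcal{W}^2+\mathcal{A}=0$ hold.
   Context: Setting. $E^4$ is $\mathbb{R}^4$ with its standard inner product $\langle\cdot,\cdot\rangle$ and orientation; the ternary vector product $x\times y\times z$ is the formal determinant of the $4\times4$ matrix whose first row is the standard basis $(e_1,e_2,e_3,e_4)$ and whose remaining rows are $x,y,z$. Subscripts $s,t$ denote partial derivatives. $\Psi=\Psi(s,t)$ is a smooth map from a product of two open intervals to $E^4$ whose $s$-parameter curves $s\mapsto\Psi(s,t)$ are unit speed for all $t$. A parallel transport frame field is a smooth positively oriented orthonormal frame $\{\mathcal{T},\mathcal{P}_1,\mathcal{P}_2,\mathcal{P}_3\}$ along $\Psi$ with $\mathcal{T}=\Psi_s$, $\mathcal{T}_s=k_1\mathcal{P}_1+k_2\mathcal{P}_2+k_3\mathcal{P}_3$ and $(\mathcal{P}_i)_s=-k_i\mathcal{T}$; $k_1,k_2,k_3$ are its curvature functions. Put $\mathfrak{a}_{23}=\langle(\mathcal{P}_1)_t,\mathcal{P}_2\rangle$, $\mathfrak{a}_{24}=\langle(\mathcal{P}_1)_t,\mathcal{P}_3\rangle$, $\mathfrak{a}_{34}=\langle(\mathcal{P}_2)_t,\mathcal{P}_3\rangle$, $P=k_3(k_2)_s-k_2(k_3)_s$,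 $R=k_1(k_3)_s-k_3(k_1)_s$, $S=k_2(k_1)_s-k_1(k_2)_s$, $Q=\sqrt{k_1^2+k_2^2+k_3^2}$, $\mathcal{W}=\sqrt{P^2+R^2+S^2}$, and $\mathcal{A}=(Pk_3-Sk_1)\mathfrak{a}_{24}+(Pk_2-Rk_1)\mathfrak{a}_{23}+(Rk_3-Sk_2)\mathfrak{a}_{34}-R(k_2)_t-S(k_3)_t-P(k_1)_t$, $\mathcal{B}=\mathcal{W}^2(k_1\mathfrak{a}_{34}-k_2\mathfrak{a}_{24}+k_3\mathfrak{a}_{23})+S(k_2P_t-k_1R_t)+R(k_1S_t-k_3P_t)+P(k_3R_t-k_2S_t)$. Standing assumptions: at least two of $k_1,k_2,k_3$ are non-zero, and $P,R,S$ are not all zero at any point. A surface is minimal if its mean curvature vector field $\vec{H}=\tfrac12\big(\operatorname{tr}(A_{N_1})N_1+\operatorname{tr}(A_{N_2})N_2\big)$ vanishes identically, where $A_{N_1},A_{N_2}$ are the shape operators with respect to an orthonormal frame $N_1,N_2$ of the normal bundle. The equations in the claim are identities of functions of $(s,t)$. *)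

theory Defs
  imports "HOL-Analysis.Analysis"
begin

section \<open>Smooth maps of two parameters\<close>

definition ds :: "(real \<times> real \<Rightarrow> 'a::real_normed_vector) \<Rightarrow> real \<times> real \<Rightarrow> 'a" where
  "ds f p = vector_derivative (\<lambda>x. f (x, snd p)) (at (fst p))"

definition dt :: "(real \<times> real \<Rightarrow> 'a::real_normed_vector) \<Rightarrow> real \<times> real \<Rightarrow> 'a" where
  "dt f p = vector_derivative (\<lambda>y. f (fst p, y)) (at (snd p))"

text \<open>Only used for open \<open>U\<close>, where the partial derivatives at points of \<open>U\<close> do not
  depend on the values of \<open>f\<close> outside \<open>U\<close>.\<close>

primrec Ck_on :: "nat \<Rightarrow> (real \<times> real \<Rightarrow> 'a::real_normed_vector) \<Rightarrow> (real \<times> real) set \<Rightarrow> bool" where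
  "Ck_on 0 f U \<longleftrightarrow> continuous_on U f"
| "Ck_on (Suc k) f U \<longleftrightarrow> f differentiable_on U \<and> Ck_on k (ds f) U \<and> Ck_on k (dt f) U"

definition smooth_on :: "(real \<times> real \<Rightarrow> 'a::real_normed_vector) \<Rightarrow> (real \<times> real) set \<Rightarrow> bool" where
  "smooth_on f U \<longleftrightarrow> (\<forall>k. Ck_on k f U)"

definition open_interval :: "real set \<Rightarrow> bool" where
  "open_interval I \<longleftrightarrow> open I \<and> is_interval I \<and> I \<noteq> {}"


section \<open>The ternary vector product\<close>

text \<open>The formal determinant with first row \<open>(e\<^sub>1, e\<^sub>2, e\<^sub>3, e\<^sub>4)\<close>, expanded along that row: its
  \<open>i\<close>-th component is obtained by replacing the first row by \<open>axis i 1\<close>. With this convention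
  \<open>triple_cross e\<^sub>1 e\<^sub>2 e\<^sub>3 = - e\<^sub>4\<close>.\<close>

definition triple_cross :: "real^4 \<Rightarrow> real^4 \<Rightarrow> real^4 \<Rightarrow> real^4" where
  "triple_cross x y z = (\<chi> i. det (vector [axis i 1, x, y, z] :: real^4^4))"


section \<open>Mean curvature of a parametrized surface\<close>

definition tangent_plane :: "(real \<times> real \<Rightarrow> real^4) \<Rightarrow> real \<times> real \<Rightarrow> (real^4) set" where
  "tangent_plane \<Psi> p = range (frechet_derivative \<Psi> (at p))"

definition orthogonal_projection :: "(real^4) set \<Rightarrow> real^4 \<Rightarrow> real^4" where
  "orthogonal_projection V x = (THE y. y \<in> V \<and> (\<forall>v\<in>V. (x - y) \<bullet> v = 0))"

text \<open>Weingarten formula: \<open>A\<^sub>N X\<close> is minus the tangential component of the derivative of \<open>N\<close> in the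
  direction of the tangent vector \<open>X\<close>. As \<open>N\<close> is a function of the parameters, \<open>X\<close> is first pulled
  back to the parameter plane; at a regular point of \<open>\<Psi>\<close> the differential is injective, so \<open>inv\<close> gives
  the unique preimage of \<open>X\<close>.\<close>

definition shape_operator ::
  "(real \<times> real \<Rightarrow> real^4) \<Rightarrow> (real \<times> real \<Rightarrow> real^4) \<Rightarrow> real \<times> real \<Rightarrow> real^4 \<Rightarrow> real^4" where
  "shape_operator \<Psi> N p X =
     - orthogonal_projection (tangent_plane \<Psi> p)
         (frechet_derivative N (at p) (inv (frechet_derivative \<Psi> (at p)) X))"

definition trace_on :: "(real^4) set \<Rightarrow> (real^4 \<Rightarrow> real^4) \<Rightarrow> real" where
  "trace_on V L =
     (let B = (SOME B. independent B \<and> span B = V) in \<Sum>b\<in>B. representation B (L b) b)"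

text \<open>The trace does not depend on the basis chosen in its definition.\<close>

lemma trace_on_eq:
  fixes L :: "real^4 \<Rightarrow> real^4"
  assumes C: "independent C" "span C = V"
    and add: "\<And>x y. x \<in> V \<Longrightarrow> y \<in> V \<Longrightarrow> L (x + y) = L x + L y"
    and scale: "\<And>c x. x \<in> V \<Longrightarrow> L (c *\<^sub>R x) = c *\<^sub>R L x"
    and maps: "\<And>x. x \<in> V \<Longrightarrow> L x \<in> V"
  shows "trace_on V L = (\<Sum>c\<in>C. representation C (L c) c)"
proof -
  define B where "B = (SOME B. independent B \<and> span B = V)"
  have B: "independent B" "span B = V"
    using someI[of "\<lambda>B. independent B \<and> span B = V" C] C unfolding B_def by auto
  have fin: "finite B" "finite C"
    using B C independent_bound by auto
  have inV: "x \<in> V" if "x \<in> B \<or> x \<in> C" for x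
    using that B C span_base by metis
  have sub: "subspace V"
    using B(2) subspace_span by metis
  have L_sum: "L (\<Sum>x\<in>A. g x *\<^sub>R x) = (\<Sum>x\<in>A. g x *\<^sub>R L x)"
    if "finite A" "A \<subseteq> V" for A and g :: "real^4 \<Rightarrow> real"
    using that
  proof (induction A rule: finite_induct)
    case empty
    show ?case using scale[of 0 0] subspace_0[OF sub] by simp
  next
    case (insert x A)
    then have "(\<Sum>x\<in>A. g x *\<^sub>R x) \<in> V" "g x *\<^sub>R x \<in> V"
      by (auto intro!: subspace_sum[OF sub] subspace_scale[OF sub])
    then show ?case using insert by (simp add: add scale)
  qed
  have rep_sum: "representation D (\<Sum>x\<in>A. g x *\<^sub>R f x) d = (\<Sum>x\<in>A. g x * representation D (f x) d)"
    if "independent D" "span D = V" "\<And>x. x \<in> A \<Longrightarrow> f x \<in> V"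
    for A D d and g :: "real^4 \<Rightarrow> real" and f :: "real^4 \<Rightarrow> real^4"
    using that by (simp add: real_vector.representation_sum real_vector.representation_scale
        subspace_scale[OF sub])
  have expand: "(\<Sum>d\<in>D. representation D x d *\<^sub>R d) = x"
    if "independent D" "span D = V" "finite D" "x \<in> V" for D x
    using real_vector.sum_representation_eq[of D x D] that by auto
  have "trace_on V L = (\<Sum>b\<in>B. representation B (L b) b)"
    by (simp add: trace_on_def B_def Let_def)
  also have "\<dots> = (\<Sum>b\<in>B. \<Sum>c\<in>C. representation C b c * representation B (L c) b)"
  proof (rule sum.cong)
    fix b assume "b \<in> B"
    then have "L b = (\<Sum>c\<in>C. representation C b c *\<^sub>R L c)"
      using L_sum[of C "representation C b"] expand[of C b] C fin inV by auto
    then show "representation B (L b) b =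
        (\<Sum>c\<in>C. representation C b c * representation B (L c) b)"
      using rep_sum[OF B, of C L "representation C b" b] maps inV by auto
  qed simp
  also have "\<dots> = (\<Sum>c\<in>C. \<Sum>b\<in>B. representation B (L c) b * representation C b c)"
    by (subst sum.swap) (simp add: mult.commute)
  also have "\<dots> = (\<Sum>c\<in>C. representation C (L c) c)"
  proof (rule sum.cong)
    fix c assume "c \<in> C"
    then have "L c = (\<Sum>b\<in>B. representation B (L c) b *\<^sub>R b)"
      using expand[of B "L c"] B fin maps inV by auto
    then show "(\<Sum>b\<in>B. representation B (L c) b * representation C b c) = representation C (L c) c"
      using rep_sum[OF C, of B "\<lambda>b. b" "representation B (L c)" c] inV by simp
  qed simp
  finally show ?thesis .
qed

definition orthonormal_normal_frame ::
  "(real \<times> real \<Rightarrow> real^4) \<Rightarrow> (real \<times> real) set \<Rightarrow>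
   (real \<times> real \<Rightarrow> real^4) \<Rightarrow> (real \<times> real \<Rightarrow> real^4) \<Rightarrow> bool" where
  "orthonormal_normal_frame \<Psi> U N1 N2 \<longleftrightarrow>
     smooth_on N1 U \<and> smooth_on N2 U \<and>
     (\<forall>p\<in>U. norm (N1 p) = 1 \<and> norm (N2 p) = 1 \<and> N1 p \<bullet> N2 p = 0 \<and>
        (\<forall>X\<in>tangent_plane \<Psi> p. N1 p \<bullet> X = 0 \<and> N2 p \<bullet> X = 0))"

definition mean_curvature_vector ::
  "(real \<times> real \<Rightarrow> real^4) \<Rightarrow> (real \<times> real \<Rightarrow> real^4) \<Rightarrow> (real \<times> real \<Rightarrow> real^4) \<Rightarrow>
   real \<times> real \<Rightarrow> real^4" where
  "mean_curvature_vector \<Psi> N1 N2 p =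
     (1/2) *\<^sub>R (trace_on (tangent_plane \<Psi> p) (shape_operator \<Psi> N1 p) *\<^sub>R N1 p +
              trace_on (tangent_plane \<Psi> p) (shape_operator \<Psi> N2 p) *\<^sub>R N2 p)"

text \<open>For a regular surface the mean curvature vector does not depend on the orthonormal normal
  frame. The normal bundle is trivial over a product of intervals, so a global frame exists there;
  the existential quantifier keeps minimality from holding vacuously.\<close>

definition minimal_surface :: "(real \<times> real \<Rightarrow> real^4) \<Rightarrow> (real \<times> real) set \<Rightarrow> bool" where
  "minimal_surface \<Psi> U \<longleftrightarrow>
     (\<exists>N1 N2. orthonormal_normal_frame \<Psi> U N1 N2 \<and>
        (\<forall>p\<in>U. mean_curvature_vector \<Psi> N1 N2 p = 0))"


section \<open>Parallel transport frame\<close>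

definition parallel_transport_frame ::
  "(real \<times> real \<Rightarrow> real^4) \<Rightarrow> (real \<times> real) set \<Rightarrow>
   (real \<times> real \<Rightarrow> real^4) \<Rightarrow> (real \<times> real \<Rightarrow> real^4) \<Rightarrow>
   (real \<times> real \<Rightarrow> real^4) \<Rightarrow> (real \<times> real \<Rightarrow> real^4) \<Rightarrow>
   (real \<times> real \<Rightarrow> real) \<Rightarrow> (real \<times> real \<Rightarrow> real) \<Rightarrow> (real \<times> real \<Rightarrow> real) \<Rightarrow> bool" where
  "parallel_transport_frame \<Psi> U T P1 P2 P3 k1 k2 k3 \<longleftrightarrow>
     smooth_on T U \<and> smooth_on P1 U \<and> smooth_on P2 U \<and> smooth_on P3 U \<and>
     (\<forall>p\<in>U.
        norm (T p) = 1 \<and> norm (P1 p) = 1 \<and> norm (P2 p) = 1 \<and> norm (P3 p) = 1 \<and>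
        T p \<bullet> P1 p = 0 \<and> T p \<bullet> P2 p = 0 \<and> T p \<bullet> P3 p = 0 \<and>
        P1 p \<bullet> P2 p = 0 \<and> P1 p \<bullet> P3 p = 0 \<and> P2 p \<bullet> P3 p = 0 \<and>
        det (vector [T p, P1 p, P2 p, P3 p] :: real^4^4) > 0 \<and>
        T p = ds \<Psi> p \<and>
        ds T p = k1 p *\<^sub>R P1 p + k2 p *\<^sub>R P2 p + k3 p *\<^sub>R P3 p \<and>
        ds P1 p = - (k1 p *\<^sub>R T p) \<and>
        ds P2 p = - (k2 p *\<^sub>R T p) \<and>
        ds P3 p = - (k3 p *\<^sub>R T p))"

context
  fixes P1 P2 P3 :: "real \<times> real \<Rightarrow> real^4"
begin

definition fa23 :: "real \<times> real \<Rightarrow> real" where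
  "fa23 p = dt P1 p \<bullet> P2 p"

definition fa24 :: "real \<times> real \<Rightarrow> real" where
  "fa24 p = dt P1 p \<bullet> P3 p"

definition fa34 :: "real \<times> real \<Rightarrow> real" where
  "fa34 p = dt P2 p \<bullet> P3 p"

end

context
  fixes k1 k2 k3 :: "real \<times> real \<Rightarrow> real"
begin

definition curv_P :: "real \<times> real \<Rightarrow> real" where
  "curv_P p = k3 p * ds k2 p - k2 p * ds k3 p"

definition curv_R :: "real \<times> real \<Rightarrow> real" where
  "curv_R p = k1 p * ds k3 p - k3 p * ds k1 p"

definition curv_S :: "real \<times> real \<Rightarrow> real" where
  "curv_S p = k2 p * ds k1 p - k1 p * ds k2 p"

definition curv_Q :: "real \<times> real \<Rightarrow> real" where
  "curv_Q p = sqrt ((k1 p)\<^sup>2 + (k2 p)\<^sup>2 + (k3 p)\<^sup>2)"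

definition curv_W :: "real \<times> real \<Rightarrow> real" where
  "curv_W p = sqrt ((curv_P p)\<^sup>2 + (curv_R p)\<^sup>2 + (curv_S p)\<^sup>2)"

definition curv_A :: "(real \<times> real \<Rightarrow> real^4) \<Rightarrow> (real \<times> real \<Rightarrow> real^4) \<Rightarrow> (real \<times> real \<Rightarrow> real^4) \<Rightarrow>
    real \<times> real \<Rightarrow> real" where
  "curv_A P1 P2 P3 p =
     (curv_P p * k3 p - curv_S p * k1 p) * fa24 P1 P3 p
   + (curv_P p * k2 p - curv_R p * k1 p) * fa23 P1 P2 p
   + (curv_R p * k3 p - curv_S p * k2 p) * fa34 P2 P3 p
   - curv_R p * dt k2 p - curv_S p * dt k3 p - curv_P p * dt k1 p"

definition curv_B :: "(real \<times> real \<Rightarrow> real^4) \<Rightarrow> (real \<times> real \<Rightarrow> real^4) \<Rightarrow> (real \<times> real \<Rightarrow> real^4) \<Rightarrow>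
    real \<times> real \<Rightarrow> real" where
  "curv_B P1 P2 P3 p =
     (curv_W p)\<^sup>2 * (k1 p * fa34 P2 P3 p - k2 p * fa24 P1 P3 p + k3 p * fa23 P1 P2 p)
   + curv_S p * (k2 p * dt curv_P p - k1 p * dt curv_R p)
   + curv_R p * (k1 p * dt curv_S p - k3 p * dt curv_P p)
   + curv_P p * (k3 p * dt curv_R p - k2 p * dt curv_S p)"

end

end

theory Submission
  imports Defs
begin

text \<open>Write $K = \Psi_{ss}$ and $V = \Psi_t$. In the parallel frame the evolution equation reads
  $V = P\mathcal{P}_1 + R\mathcal{P}_2 + S\mathcal{P}_3 = -K \times K_s$ (cross product in the span of the
  $\mathcal{P}_i$), so $(s,t)$ are orthogonal parameters with $|\Psi_s| = 1$ and $|\Psi_t| = \mathcal{W}$.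
  Hence $2\vec{H}$ is the normal part of $\Psi_{ss} + \Psi_{tt}/\mathcal{W}^2$. The normal plane
  is spanned by the orthogonal vectors $K$ and $K \times V$; pairing $\Psi_{tt}$ with them gives
  $\mathcal{A}$ and $\mathcal{B}$, while pairing $\Psi_{ss}$ with them gives $Q^2$ and $0$.\<close>

section \<open>Partial derivatives and smooth functions\<close>

text \<open>Chain rule along the two axis-parallel lines through \<open>p\<close>. Any known total
  derivative thus yields both partial derivatives by evaluation at the basis vectors, which is how
  all the rules for \<open>ds\<close> and \<open>dt\<close> below are obtained.\<close>

lemma partials_eqI:
  assumes "(f has_derivative D) (at p)"
  shows "ds f p = D (1, 0)" and "dt f p = D (0, 1)"
proof -
  interpret D: bounded_linear D
    using assms by (rule has_derivative_bounded_linear)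
  have lin: "D (h, 0) = h *\<^sub>R D (1, 0)" "D (0, h) = h *\<^sub>R D (0, 1)" for h
    by (simp_all flip: D.scaleR)
  have "((\<lambda>x. f (x, snd p)) has_derivative (\<lambda>h. D (h, 0))) (at (fst p))"
    by (rule has_derivative_compose[where f = "\<lambda>x. (x, snd p)" and g = f])
      (auto intro!: derivative_eq_intros assms)
  then show "ds f p = D (1, 0)"
    unfolding ds_def by (intro vector_derivative_at) (simp add: has_vector_derivative_def flip: lin)
  have "((\<lambda>y. f (fst p, y)) has_derivative (\<lambda>h. D (0, h))) (at (snd p))"
    by (rule has_derivative_compose[where f = "\<lambda>y. (fst p, y)" and g = f])
      (auto intro!: derivative_eq_intros assms)
  then show "dt f p = D (0, 1)"
    unfolding dt_def by (intro vector_derivative_at) (simp add: has_vector_derivative_def flip: lin)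
qed

text \<open>Linearity of the derivative on the basis \<open>(1, 0)\<close>, \<open>(0, 1)\<close>.
  It gives differentiability the explicit shape in which derivative rules can be composed and then
  read off again with \<open>partials_eqI\<close>.\<close>

lemma has_derivative_partials:
  assumes "f differentiable at p"
  shows "(f has_derivative (\<lambda>h. fst h *\<^sub>R ds f p + snd h *\<^sub>R dt f p)) (at p)"
proof -
  obtain D where D: "(f has_derivative D) (at p)"
    using assms by (auto simp: differentiable_def)
  interpret D: bounded_linear D
    using D by (rule has_derivative_bounded_linear)
  have "D h = fst h *\<^sub>R ds f p + snd h *\<^sub>R dt f p" for h
  proof -
    have "h = fst h *\<^sub>R (1, 0) + snd h *\<^sub>R (0, 1)"
      by (simp add: prod_eq_iff)
    then show ?thesis
      unfolding partials_eqI[OF D] by (metis D.add D.scaleR)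
  qed
  then show ?thesis using D by (metis (no_types, lifting) ext)
qed

text \<open>An open set contains a box around \<open>p\<close>, so both coordinate lines stay in
  \<open>U\<close> near \<open>p\<close>. This is what allows identities known only on the domain of
  the surface to be differentiated.\<close>

lemma partials_cong:
  assumes "open U" "p \<in> U" "\<And>q. q \<in> U \<Longrightarrow> f q = g q"
  shows "ds f p = ds g p" and "dt f p = dt g p"
proof -
  obtain A B where AB: "open A" "open B" "p \<in> A \<times> B" "A \<times> B \<subseteq> U"
    using assms(1,2) by (auto elim: open_prod_elim)
  have "eventually (\<lambda>x. f (x, snd p) = g (x, snd p)) (nhds (fst p))"
    using AB assms(3) by (intro eventually_nhds[THEN iffD2] exI[of _ A]) auto
  then show "ds f p = ds g p"
    unfolding ds_def by (intro vector_derivative_cong_eq) auto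
  have "eventually (\<lambda>y. f (fst p, y) = g (fst p, y)) (nhds (snd p))"
    using AB assms(3) by (intro eventually_nhds[THEN iffD2] exI[of _ B]) auto
  then show "dt f p = dt g p"
    unfolding dt_def by (intro vector_derivative_cong_eq) auto
qed

lemma partials_const [simp]: "ds (\<lambda>p. c) p = 0" "dt (\<lambda>p. c) p = 0"
  by (auto simp: partials_eqI[OF has_derivative_const])

lemma partials_add:
  assumes "f differentiable at p" "g differentiable at p"
  shows "ds (\<lambda>p. f p + g p) p = ds f p + ds g p" "dt (\<lambda>p. f p + g p) p = dt f p + dt g p"
  using partials_eqI[OF has_derivative_add[OF assms[THEN has_derivative_partials]]] by auto

lemma partials_bilinear:
  assumes "bounded_bilinear B" "f differentiable at p" "g differentiable at p"
  shows "ds (\<lambda>p. B (f p) (g p)) p = B (f p) (ds g p) + B (ds f p) (g p)"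
    and "dt (\<lambda>p. B (f p) (g p)) p = B (f p) (dt g p) + B (dt f p) (g p)"
  using partials_eqI[OF bounded_bilinear.FDERIV[OF assms(1) assms(2,3)[THEN has_derivative_partials]]]
  by (auto simp: bounded_bilinear.zero_left[OF assms(1)] bounded_bilinear.zero_right[OF assms(1)])

lemmas partials_scaleR = partials_bilinear[OF bounded_bilinear_scaleR]
lemmas partials_inner = partials_bilinear[OF bounded_bilinear_inner]

section \<open>Closure properties of maps with k continuous derivatives\<close>

lemma differentiable_on_cong:
  assumes "\<And>x. x \<in> U \<Longrightarrow> f x = g x" "f differentiable_on U"
  shows "g differentiable_on U"
  unfolding differentiable_on_def
proof
  fix x assume "x \<in> U"
  then obtain D where "(f has_derivative D) (at x within U)"
    using assms(2) by (auto simp: differentiable_on_def differentiable_def)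
  then have "(g has_derivative D) (at x within U)"
    using has_derivative_transform[of x U g f D] \<open>x \<in> U\<close> assms(1) by metis
  then show "g differentiable (at x within U)"
    by (rule differentiableI)
qed

lemma Ck_on_cong:
  assumes "open U" "\<And>p. p \<in> U \<Longrightarrow> f p = g p" "Ck_on k f U"
  shows "Ck_on k g U"
  using assms(2,3)
proof (induction k arbitrary: f g)
  case 0
  then show ?case using continuous_on_cong[of U U f g] by simp
next
  case (Suc k)
  note eq = partials_cong[OF assms(1) _ Suc.prems(1)]
  have "Ck_on k (ds g) U"
    by (rule Suc.IH[of "ds f"]) (use eq Suc.prems(2) in auto)
  moreover have "Ck_on k (dt g) U"
    by (rule Suc.IH[of "dt f"]) (use eq Suc.prems(2) in auto)
  moreover have "g differentiable_on U"
    by (rule differentiable_on_cong[of U f]) (use Suc.prems in auto)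
  ultimately show ?case by simp
qed

lemma Ck_on_Suc_imp: "Ck_on (Suc k) f U \<Longrightarrow> Ck_on k f U"
proof (induction k arbitrary: f)
  case (Suc k)
  then show ?case
    using Suc.IH[of "ds f"] Suc.IH[of "dt f"] Ck_on.simps(2)[of "Suc k" f U]
      Ck_on.simps(2)[of k f U] by blast
qed (simp add: differentiable_imp_continuous_on)

lemma Ck_on_const: "Ck_on k (\<lambda>p. c) U"
proof (induction k arbitrary: c)
  case (Suc k)
  have "ds (\<lambda>p. c) = (\<lambda>p. 0)" "dt (\<lambda>p. c) = (\<lambda>p. 0)"
    by (auto simp: fun_eq_iff)
  with Suc show ?case by simp
qed simp

text \<open>The partial derivatives are supplied as candidates \<open>a\<close> and
  \<open>b\<close>, which agree with \<open>ds f\<close> and \<open>dt f\<close> on \<open>U\<close>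
  only; \<open>Ck_on_cong\<close> bridges the difference. Each induction on \<open>k\<close> below
  ends with this rule.\<close>

lemma Ck_on_SucI:
  assumes "open U"
    and "\<And>p. p \<in> U \<Longrightarrow> (f has_derivative (\<lambda>h. fst h *\<^sub>R a p + snd h *\<^sub>R b p)) (at p)"
    and "Ck_on k a U" "Ck_on k b U"
  shows "Ck_on (Suc k) f U"
proof -
  have "Ck_on k (ds f) U"
    by (rule Ck_on_cong[OF assms(1) _ assms(3)]) (simp add: partials_eqI(1)[OF assms(2)])
  moreover have "Ck_on k (dt f) U"
    by (rule Ck_on_cong[OF assms(1) _ assms(4)]) (simp add: partials_eqI(2)[OF assms(2)])
  moreover have "f differentiable_on U"
    using differentiableI[OF assms(2)] by (intro differentiable_at_imp_differentiable_on)
  ultimately show ?thesis by simp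
qed

lemma Ck_on_has_derivative:
  assumes "Ck_on (Suc k) f U" "open U" "p \<in> U"
  shows "(f has_derivative (\<lambda>h. fst h *\<^sub>R ds f p + snd h *\<^sub>R dt f p)) (at p)"
  using assms by (intro has_derivative_partials) (simp add: differentiable_on_eq_differentiable_at)

lemma Ck_on_add:
  assumes "open U"
  shows "Ck_on k f U \<Longrightarrow> Ck_on k g U \<Longrightarrow> Ck_on k (\<lambda>p. f p + g p) U"
proof (induction k arbitrary: f g)
  case 0
  then show ?case by (auto intro: continuous_on_add)
next
  case (Suc k)
  note D = Suc.prems[THEN Ck_on_has_derivative, OF assms]
  have "((\<lambda>p. f p + g p) has_derivative
      (\<lambda>h. fst h *\<^sub>R (ds f p + ds g p) + snd h *\<^sub>R (dt f p + dt g p))) (at p)" if "p \<in> U" for p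
    using has_derivative_add[OF D[OF that]] by (simp add: algebra_simps)
  moreover have "Ck_on k (\<lambda>p. ds f p + ds g p) U" "Ck_on k (\<lambda>p. dt f p + dt g p) U"
    using Suc.prems by (auto intro: Suc.IH)
  ultimately show ?case
    by (rule Ck_on_SucI[OF assms])
qed

text \<open>By the product rule each partial derivative is a sum of products of one factor with a
  derivative of the other. The undifferentiated factor is lowered by one order so that the induction
  hypothesis applies.\<close>

lemma Ck_on_bilinear:
  assumes "bounded_bilinear B" "open U"
  shows "Ck_on k f U \<Longrightarrow> Ck_on k g U \<Longrightarrow> Ck_on k (\<lambda>p. B (f p) (g p)) U"
proof (induction k arbitrary: f g)
  case 0
  then show ?case by (auto intro: bounded_bilinear.continuous_on[OF assms(1)])
next
  case (Suc k)
  interpret B: bounded_bilinear B by fact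
  note D = Suc.prems[THEN Ck_on_has_derivative, OF assms(2)]
  have "((\<lambda>p. B (f p) (g p)) has_derivative
      (\<lambda>h. fst h *\<^sub>R (B (f p) (ds g p) + B (ds f p) (g p)) +
        snd h *\<^sub>R (B (f p) (dt g p) + B (dt f p) (g p)))) (at p)" if "p \<in> U" for p
    using B.FDERIV[OF D[OF that]]
    by (simp add: B.add_left B.add_right B.scaleR_left B.scaleR_right algebra_simps)
  moreover have "Ck_on k f U" "Ck_on k g U"
    using Suc.prems Ck_on_Suc_imp by auto
  then have "Ck_on k (\<lambda>p. B (f p) (ds g p) + B (ds f p) (g p)) U"
    "Ck_on k (\<lambda>p. B (f p) (dt g p) + B (dt f p) (g p)) U"
    using Suc.prems by (auto intro!: Ck_on_add[OF assms(2)] Suc.IH)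
  ultimately show ?case
    by (rule Ck_on_SucI[OF assms(2)])
qed

text \<open>The function g = f^(-1/2) satisfies dg = -(1/2) g^3 df. Its derivative is a polynomial
  in g and df, so the induction closes without a general chain rule.\<close>

lemma Ck_on_inverse_sqrt:
  fixes f :: "real \<times> real \<Rightarrow> real"
  assumes "open U" "\<And>p. p \<in> U \<Longrightarrow> f p > 0"
  shows "Ck_on k f U \<Longrightarrow> Ck_on k (\<lambda>p. inverse (sqrt (f p))) U"
proof (induction k)
  case 0
  have "sqrt (f p) \<noteq> 0" if "p \<in> U" for p
    using assms(2)[OF that] by simp
  with 0 show ?case by (auto intro!: continuous_intros simp del: real_sqrt_eq_zero_cancel_iff)
next
  case (Suc k)
  define g where "g p = inverse (sqrt (f p))" for p
  let ?c = "\<lambda>p. (-(1/2)) * (g p * (g p * g p))"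
  have "(g has_derivative (\<lambda>h. fst h *\<^sub>R (?c p * ds f p) + snd h *\<^sub>R (?c p * dt f p))) (at p)"
    if "p \<in> U" for p
    using Ck_on_has_derivative[OF Suc.prems assms(1) that] assms(2)[OF that]
    unfolding g_def by (auto intro!: derivative_eq_intros simp: field_simps)
  moreover have Ck: "Ck_on k g U" "Ck_on k (ds f) U" "Ck_on k (dt f) U"
    using Suc Ck_on_Suc_imp[OF Suc.prems] unfolding g_def by auto
  have "Ck_on k (\<lambda>p. ?c p * ds f p) U" "Ck_on k (\<lambda>p. ?c p * dt f p) U"
    by (intro Ck Ck_on_bilinear[OF bounded_bilinear_mult assms(1)] Ck_on_const)+
  ultimately have "Ck_on (Suc k) g U"
    by (rule Ck_on_SucI[OF assms(1)])
  then show ?case unfolding g_def .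
qed

section \<open>Closure properties of smooth maps\<close>

lemma smooth_on_cong:
  assumes "open U" "\<And>p. p \<in> U \<Longrightarrow> f p = g p" "smooth_on f U"
  shows "smooth_on g U"
  unfolding smooth_on_def
  by (intro allI Ck_on_cong[OF assms(1,2) assms(3)[unfolded smooth_on_def, rule_format]])

lemma smooth_on_partials:
  assumes "smooth_on f U"
  shows "smooth_on (ds f) U" "smooth_on (dt f) U"
  using assms[unfolded smooth_on_def, rule_format, of "Suc k" for k]
  by (simp_all add: smooth_on_def)

lemma smooth_on_differentiable:
  "open U \<Longrightarrow> smooth_on f U \<Longrightarrow> p \<in> U \<Longrightarrow> f differentiable at p"
  unfolding smooth_on_def
  by (drule spec[of _ "Suc 0"]) (simp add: differentiable_on_eq_differentiable_at)

lemma smooth_on_add: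
  "open U \<Longrightarrow> smooth_on f U \<Longrightarrow> smooth_on g U \<Longrightarrow> smooth_on (\<lambda>p. f p + g p) U"
  unfolding smooth_on_def by (rule allI, rule Ck_on_add) auto

lemma smooth_on_bilinear:
  "bounded_bilinear B \<Longrightarrow> open U \<Longrightarrow> smooth_on f U \<Longrightarrow> smooth_on g U \<Longrightarrow>
    smooth_on (\<lambda>p. B (f p) (g p)) U"
  unfolding smooth_on_def by (rule allI, rule Ck_on_bilinear) auto

lemmas smooth_on_scaleR = smooth_on_bilinear[OF bounded_bilinear_scaleR]
lemmas smooth_on_inner = smooth_on_bilinear[OF bounded_bilinear_inner]
lemmas smooth_on_mult = smooth_on_bilinear[OF bounded_bilinear_mult]

lemma smooth_on_minus:
  fixes f g :: "real \<times> real \<Rightarrow> 'a::real_normed_vector"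
  assumes "open U" "smooth_on f U" "smooth_on g U"
  shows "smooth_on (\<lambda>p. f p - g p) U"
proof -
  have "smooth_on (\<lambda>p. -1 :: real) U"
    by (simp add: smooth_on_def Ck_on_const)
  then have "smooth_on (\<lambda>p. f p + (-1) *\<^sub>R g p) U"
    using assms by (intro smooth_on_add smooth_on_scaleR)
  then show ?thesis by simp
qed

text \<open>On vectors, \<open>sgn\<close> is normalisation, that is, multiplication by the inverse
  square root of \<open>f p \<bullet> f p\<close>. It will turn nonvanishing normal fields into unit
  ones.\<close>

lemma smooth_on_sgn:
  fixes f :: "real \<times> real \<Rightarrow> 'a::real_inner"
  assumes "open U" "smooth_on f U" "\<And>p. p \<in> U \<Longrightarrow> f p \<noteq> 0"
  shows "smooth_on (\<lambda>p. sgn (f p)) U"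
proof -
  have "smooth_on (\<lambda>p. f p \<bullet> f p) U"
    using assms by (intro smooth_on_inner)
  then have "smooth_on (\<lambda>p. inverse (sqrt (f p \<bullet> f p))) U"
    using Ck_on_inverse_sqrt[OF assms(1), of "\<lambda>p. f p \<bullet> f p"] assms(3)
    by (auto simp: smooth_on_def)
  then have "smooth_on (\<lambda>p. inverse (sqrt (f p \<bullet> f p)) *\<^sub>R f p) U"
    using assms by (intro smooth_on_scaleR)
  then show ?thesis by (simp add: sgn_div_norm norm_eq_sqrt_inner)
qed

section \<open>Mean curvature in orthogonal parameters\<close>

text \<open>Two candidates differ by a vector of \<open>V\<close> that is orthogonal to
  \<open>V\<close>, hence to itself.\<close>

lemma orthogonal_projection_eq:
  assumes "subspace V" "y \<in> V" "\<And>v. v \<in> V \<Longrightarrow> (x - y) \<bullet> v = 0"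
  shows "orthogonal_projection V x = y"
  unfolding orthogonal_projection_def
proof (rule the_equality)
  fix z assume z: "z \<in> V \<and> (\<forall>v\<in>V. (x - z) \<bullet> v = 0)"
  then have "z - y \<in> V"
    using assms by (simp add: subspace_diff)
  then have "(x - y) \<bullet> (z - y) - (x - z) \<bullet> (z - y) = 0"
    using z assms(3) by simp
  then have "(z - y) \<bullet> (z - y) = 0"
    by (simp flip: inner_diff_left)
  then show "z = y" by simp
qed (use assms in auto)

lemma representation_pair:
  fixes X Y :: "'a::real_inner"
  assumes "independent {X, Y}" "X \<noteq> Y"
  shows "representation {X, Y} (a *\<^sub>R X + b *\<^sub>R Y) X = a"
    and "representation {X, Y} (a *\<^sub>R X + b *\<^sub>R Y) Y = b"
  using assms
  by (simp_all add: real_vector.representation_add real_vector.representation_scale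
      real_vector.representation_basis span_base span_scale)

text \<open>In the orthogonal basis \<Psi>_s, \<Psi>_t only the diagonal entries of the shape
  operator matter, and these are -N_s.\<Psi>_s / |\<Psi>_s|^2 and -N_t.\<Psi>_t / |\<Psi>_t|^2.
  Differentiating N.\<Psi>_s = 0 and N.\<Psi>_t = 0 moves the derivative from N to \<Psi>; for this,
  normality is assumed on all of \<open>U\<close> and not only at \<open>p\<close>.\<close>

lemma trace_shape_operator:
  assumes U: "open U" "p \<in> U" and smooth: "smooth_on \<Psi> U" "smooth_on N U"
    and orth: "ds \<Psi> p \<bullet> dt \<Psi> p = 0" and nz: "ds \<Psi> p \<noteq> 0" "dt \<Psi> p \<noteq> 0"
    and normal: "\<And>q X. q \<in> U \<Longrightarrow> X \<in> tangent_plane \<Psi> q \<Longrightarrow> N q \<bullet> X = 0"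
  shows "trace_on (tangent_plane \<Psi> p) (shape_operator \<Psi> N p) =
    N p \<bullet> (ds (ds \<Psi>) p /\<^sub>R (norm (ds \<Psi> p))\<^sup>2 + dt (dt \<Psi>) p /\<^sub>R (norm (dt \<Psi> p))\<^sup>2)"
proof -
  define X Y where "X = ds \<Psi> p" and "Y = dt \<Psi> p"
  define D where "D h = fst h *\<^sub>R X + snd h *\<^sub>R Y" for h :: "real \<times> real"
  define DN where "DN h = fst h *\<^sub>R ds N p + snd h *\<^sub>R dt N p" for h :: "real \<times> real"
  define pr where "pr Z = (Z \<bullet> X / (norm X)\<^sup>2) *\<^sub>R X + (Z \<bullet> Y / (norm Y)\<^sup>2) *\<^sub>R Y" for Z
  note diff = smooth_on_differentiable[OF U(1)]
  have XY: "X \<bullet> Y = 0" "Y \<bullet> X = 0" "X \<noteq> 0" "Y \<noteq> 0"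
    using orth nz unfolding X_def Y_def by (auto simp: inner_commute)
  then have ne: "X \<noteq> Y" by auto
  have frechet: "frechet_derivative f (at q) = (\<lambda>h. fst h *\<^sub>R ds f q + snd h *\<^sub>R dt f q)"
    if "smooth_on f U" "q \<in> U" for f :: "real \<times> real \<Rightarrow> real^4" and q
    using frechet_derivative_at[OF has_derivative_partials[OF diff[OF that]]] by simp
  have D: "frechet_derivative \<Psi> (at p) = D" and DN: "frechet_derivative N (at p) = DN"
    using frechet[OF smooth(1) U(2)] frechet[OF smooth(2) U(2)]
    by (auto simp: fun_eq_iff D_def DN_def X_def Y_def)
  have XX: "X \<bullet> X > 0" "Y \<bullet> Y > 0"
    using XY by simp_all
  have D_X: "D h \<bullet> X = fst h * (X \<bullet> X)" and D_Y: "D h \<bullet> Y = snd h * (Y \<bullet> Y)" for h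
    using XY by (simp_all add: D_def inner_add_left)
  \<comment> \<open>Pairing with \<open>X\<close> and \<open>Y\<close> recovers the coordinates of
    \<open>h\<close>. Injectivity makes the \<open>inv\<close> in \<open>shape_operator\<close> a
    genuine preimage.\<close>
  have inj: "inj D"
  proof (rule injI)
    fix h k assume "D h = D k"
    then have "D h \<bullet> X = D k \<bullet> X" "D h \<bullet> Y = D k \<bullet> Y" by simp_all
    then show "h = k"
      using XX unfolding D_X D_Y by (simp add: prod_eq_iff)
  qed
  have lin: "linear D"
    by (rule linearI) (simp_all add: D_def algebra_simps)
  define V where "V = tangent_plane \<Psi> p"
  have V: "V = range D"
    by (simp add: V_def tangent_plane_def D)
  have sub: "subspace V"
    unfolding V by (rule linear_subspace_image[OF lin]) simp
  have indep: "independent {X, Y}"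
    using XY by (intro pairwise_orthogonal_independent) (auto simp: pairwise_def orthogonal_def)
  have span: "span {X, Y} = V"
  proof
    have "X = D (1, 0)" "Y = D (0, 1)" by (simp_all add: D_def)
    then show "span {X, Y} \<subseteq> V"
      by (intro span_minimal sub) (auto simp: V)
    show "V \<subseteq> span {X, Y}"
      unfolding V by (rule image_subsetI) (unfold D_def, intro span_add span_scale span_base, auto)
  qed
  have proj: "orthogonal_projection V Z = pr Z" for Z
  proof (rule orthogonal_projection_eq[OF sub])
    have "pr Z = D (Z \<bullet> X / (norm X)\<^sup>2, Z \<bullet> Y / (norm Y)\<^sup>2)"
      by (simp add: pr_def D_def)
    then show "pr Z \<in> V" by (simp add: V)
    fix v assume "v \<in> V"
    then obtain h where "v = D h" by (auto simp: V)
    then show "(Z - pr Z) \<bullet> v = 0"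
      using XY by (simp add: D_def pr_def inner_diff_left inner_add_left inner_add_right
          power2_norm_eq_inner)
  qed
  have shape: "shape_operator \<Psi> N p (D h) = - pr (DN h)" for h
    using proj inj unfolding shape_operator_def D DN by (simp add: V_def)
  have pr_add: "pr (x + y) = pr x + pr y" and pr_scale: "pr (c *\<^sub>R x) = c *\<^sub>R pr x" for x y c
    by (simp_all add: pr_def inner_add_left algebra_simps add_divide_distrib)
  have DN_add: "DN (h + k) = DN h + DN k" and DN_scale: "DN (c *\<^sub>R h) = c *\<^sub>R DN h" for h k c
    by (simp_all add: DN_def algebra_simps)
  \<comment> \<open>\<open>trace_on\<close> uses an unspecified basis; \<open>trace_on_eq\<close>
    replaces it by \<open>{X, Y}\<close>. Linearity and invariance are checked on preimages under
    \<open>D\<close>, where the operator is the linear map \<open>- pr (DN h)\<close>.\<close>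
  have "trace_on V (shape_operator \<Psi> N p) =
      (\<Sum>c\<in>{X, Y}. representation {X, Y} (shape_operator \<Psi> N p c) c)"
  proof (rule trace_on_eq[OF indep span])
    fix x y assume "x \<in> V" "y \<in> V"
    then obtain h k where "x = D h" "y = D k" by (auto simp: V)
    then show "shape_operator \<Psi> N p (x + y) = shape_operator \<Psi> N p x + shape_operator \<Psi> N p y"
      by (simp add: shape DN_add pr_add flip: linear_add[OF lin])
  next
    fix c x assume "x \<in> V"
    then obtain h where "x = D h" by (auto simp: V)
    then show "shape_operator \<Psi> N p (c *\<^sub>R x) = c *\<^sub>R shape_operator \<Psi> N p x"
      by (simp add: shape DN_scale pr_scale flip: linear_scale[OF lin])
  next
    fix x assume "x \<in> V"
    then obtain h where "x = D h" by (auto simp: V)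
    moreover have "pr Z \<in> V" for Z
      unfolding span[symmetric] pr_def by (intro span_add span_scale span_base) auto
    ultimately show "shape_operator \<Psi> N p x \<in> V"
      using subspace_neg[OF sub] by (simp add: shape)
  qed
  also have "\<dots> = representation {X, Y} (- pr (ds N p)) X + representation {X, Y} (- pr (dt N p)) Y"
    using shape[of "(1, 0)"] shape[of "(0, 1)"] ne by (simp add: D_def DN_def)
  also have "- pr Z = (- (Z \<bullet> X / (norm X)\<^sup>2)) *\<^sub>R X + (- (Z \<bullet> Y / (norm Y)\<^sup>2)) *\<^sub>R Y" for Z
    by (simp add: pr_def)
  then have "representation {X, Y} (- pr (ds N p)) X + representation {X, Y} (- pr (dt N p)) Y =
      - (ds N p \<bullet> X / (norm X)\<^sup>2) - dt N p \<bullet> Y / (norm Y)\<^sup>2"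
    by (simp only: representation_pair[OF indep ne])
  \<comment> \<open>The s-derivative of the identity N.\<Psi>_s = 0, valid on \<open>U\<close>; the
    t-derivative of N.\<Psi>_t = 0 is treated likewise below.\<close>
  also have "ds N p \<bullet> X = - (N p \<bullet> ds (ds \<Psi>) p)"
  proof -
    have "N q \<bullet> ds \<Psi> q = 0" if "q \<in> U" for q
      using normal[OF that, of "ds \<Psi> q"] frechet[OF smooth(1) that]
      unfolding tangent_plane_def by (metis (no_types, lifting) fst_conv snd_conv rangeI
          scaleR_one scaleR_zero_left add.right_neutral)
    then have "ds (\<lambda>q. N q \<bullet> ds \<Psi> q) p = ds (\<lambda>q. 0) p"
      by (rule partials_cong[OF U])
    then show ?thesis
      using partials_inner(1)[OF diff diff, OF smooth(2) U(2) smooth_on_partials(1)[OF smooth(1)] U(2)]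
      by (simp add: X_def)
  qed
  also have "dt N p \<bullet> Y = - (N p \<bullet> dt (dt \<Psi>) p)"
  proof -
    have "N q \<bullet> dt \<Psi> q = 0" if "q \<in> U" for q
      using normal[OF that, of "dt \<Psi> q"] frechet[OF smooth(1) that]
      unfolding tangent_plane_def by (metis (no_types, lifting) fst_conv snd_conv rangeI
          scaleR_one scaleR_zero_left add.left_neutral)
    then have "dt (\<lambda>q. N q \<bullet> dt \<Psi> q) p = dt (\<lambda>q. 0) p"
      by (rule partials_cong[OF U])
    then show ?thesis
      using partials_inner(2)[OF diff diff, OF smooth(2) U(2) smooth_on_partials(2)[OF smooth(1)] U(2)]
      by (simp add: Y_def)
  qed
  finally show ?thesis
    by (simp add: V_def X_def Y_def inner_add_right divide_inverse mult.commute)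
qed

text \<open>Four distinct nonzero orthogonal vectors span the whole space. The difference
  \<open>y\<close> of the two sides is orthogonal to all four, hence to itself. The vectors
  \<open>a\<close> and \<open>b\<close> will be tangent, \<open>c\<close> and \<open>d\<close>
  normal.\<close>

lemma orthogonal_expansion:
  fixes a b c d x :: "real^4"
  assumes "pairwise orthogonal {a, b, c, d}" "0 \<notin> {a, b, c, d}" "card {a, b, c, d} = 4"
    and "x \<bullet> a = 0" "x \<bullet> b = 0"
  shows "x = (x \<bullet> c / (c \<bullet> c)) *\<^sub>R c + (x \<bullet> d / (d \<bullet> d)) *\<^sub>R d"
proof -
  define y where "y = x - ((x \<bullet> c / (c \<bullet> c)) *\<^sub>R c + (x \<bullet> d / (d \<bullet> d)) *\<^sub>R d)"
  have dist: "distinct [a, b, c, d]"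
    using assms(3) by (intro card_distinct) simp
  then have o: "a \<bullet> c = 0" "a \<bullet> d = 0" "b \<bullet> c = 0" "b \<bullet> d = 0" "c \<bullet> d = 0"
    using assms(1) by (auto simp: pairwise_def orthogonal_def)
  have "independent {a, b, c, d}"
    using assms(1,2) by (rule pairwise_orthogonal_independent)
  then have "span {a, b, c, d} = UNIV"
    using card_ge_dim_independent[of "{a, b, c, d}" UNIV] assms(3) by auto
  moreover have y: "y \<bullet> z = 0" if "z \<in> {a, b, c, d}" for z
    using that assms(2,4,5) o
    by (auto simp: y_def inner_diff_right inner_add_right inner_commute)
  moreover have "orthogonal y z" if "z \<in> span {a, b, c, d}" for z
    using that by (rule orthogonal_to_span) (use y in \<open>simp add: orthogonal_def\<close>)
  ultimately have "y \<bullet> y = 0"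
    by (auto simp: orthogonal_def)
  then show ?thesis by (simp add: y_def)
qed

text \<open>Twice the mean curvature vector is the normal part of \<open>Z\<close>, so minimality
  can be tested with any orthogonal normal fields without zeros; \<open>M1\<close> and
  \<open>M2\<close> need not have unit length. This removes the existential choice of a frame from
  \<open>minimal_surface\<close>.\<close>

lemma minimal_surface_iff:
  assumes U: "open U" and smooth: "smooth_on \<Psi> U" "smooth_on M1 U" "smooth_on M2 U"
    and regular: "\<And>p. p \<in> U \<Longrightarrow> ds \<Psi> p \<bullet> dt \<Psi> p = 0 \<and> ds \<Psi> p \<noteq> 0 \<and> dt \<Psi> p \<noteq> 0"
    and frame: "\<And>p. p \<in> U \<Longrightarrow> M1 p \<noteq> 0 \<and> M2 p \<noteq> 0 \<and> M1 p \<bullet> M2 p = 0"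
      "\<And>p. p \<in> U \<Longrightarrow> M1 p \<bullet> ds \<Psi> p = 0 \<and> M1 p \<bullet> dt \<Psi> p = 0"
      "\<And>p. p \<in> U \<Longrightarrow> M2 p \<bullet> ds \<Psi> p = 0 \<and> M2 p \<bullet> dt \<Psi> p = 0"
  defines "Z \<equiv> \<lambda>p. ds (ds \<Psi>) p /\<^sub>R (norm (ds \<Psi> p))\<^sup>2 + dt (dt \<Psi>) p /\<^sub>R (norm (dt \<Psi> p))\<^sup>2"
  shows "minimal_surface \<Psi> U \<longleftrightarrow> (\<forall>p\<in>U. M1 p \<bullet> Z p = 0 \<and> M2 p \<bullet> Z p = 0)"
proof -
  have tangent: "tangent_plane \<Psi> p = range (\<lambda>h. fst h *\<^sub>R ds \<Psi> p + snd h *\<^sub>R dt \<Psi> p)"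
    if "p \<in> U" for p
    using frechet_derivative_at[OF has_derivative_partials[OF
          smooth_on_differentiable[OF U smooth(1) that]], symmetric]
    by (simp add: tangent_plane_def)
  have tangentI: "ds \<Psi> p \<in> tangent_plane \<Psi> p" "dt \<Psi> p \<in> tangent_plane \<Psi> p" if "p \<in> U" for p
    unfolding tangent[OF that]
    by (rule range_eqI[of _ _ "(1, 0)"], simp) (rule range_eqI[of _ _ "(0, 1)"], simp)
  \<comment> \<open>By \<open>trace_shape_operator\<close> the coefficients of twice the mean
    curvature vector in the frame are the products of \<open>N1\<close> and \<open>N2\<close> with
    \<open>Z\<close>; orthonormality separates them.\<close>
  have vanish: "mean_curvature_vector \<Psi> N1 N2 p = 0 \<longleftrightarrow> N1 p \<bullet> Z p = 0 \<and> N2 p \<bullet> Z p = 0"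
    if N: "orthonormal_normal_frame \<Psi> U N1 N2" and p: "p \<in> U" for N1 N2 p
  proof -
    have N1: "smooth_on N1 U" "\<And>q X. q \<in> U \<Longrightarrow> X \<in> tangent_plane \<Psi> q \<Longrightarrow> N1 q \<bullet> X = 0"
      and N2: "smooth_on N2 U" "\<And>q X. q \<in> U \<Longrightarrow> X \<in> tangent_plane \<Psi> q \<Longrightarrow> N2 q \<bullet> X = 0"
      and on: "N1 p \<bullet> N1 p = 1" "N2 p \<bullet> N2 p = 1" "N1 p \<bullet> N2 p = 0"
      using N p by (auto simp: orthonormal_normal_frame_def norm_eq_1)
    have "mean_curvature_vector \<Psi> N1 N2 p =
        (1/2) *\<^sub>R ((N1 p \<bullet> Z p) *\<^sub>R N1 p + (N2 p \<bullet> Z p) *\<^sub>R N2 p)" (is "?H = _")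
      using trace_shape_operator[OF U p smooth(1) N1(1) _ _ _ N1(2)]
        trace_shape_operator[OF U p smooth(1) N2(1) _ _ _ N2(2)] regular[OF p]
      by (simp add: mean_curvature_vector_def Z_def)
    moreover from this have "?H \<bullet> N1 p = (N1 p \<bullet> Z p) / 2" "?H \<bullet> N2 p = (N2 p \<bullet> Z p) / 2"
      using on by (simp_all add: inner_add_left inner_commute[of "N2 p" "N1 p"])
    ultimately show ?thesis by auto
  qed
  have expand: "x = (x \<bullet> c / (c \<bullet> c)) *\<^sub>R c + (x \<bullet> d / (d \<bullet> d)) *\<^sub>R d"
    if "p \<in> U" "x \<bullet> ds \<Psi> p = 0" "x \<bullet> dt \<Psi> p = 0" "c \<noteq> 0" "d \<noteq> 0" "c \<bullet> d = 0"
      "c \<bullet> ds \<Psi> p = 0" "c \<bullet> dt \<Psi> p = 0" "d \<bullet> ds \<Psi> p = 0" "d \<bullet> dt \<Psi> p = 0" for p x c d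
  proof (rule orthogonal_expansion[OF _ _ _ that(2,3)])
    show "pairwise orthogonal {ds \<Psi> p, dt \<Psi> p, c, d}"
      using that regular[OF that(1)] by (auto simp: pairwise_def orthogonal_def inner_commute)
    show "0 \<notin> {ds \<Psi> p, dt \<Psi> p, c, d}"
      using that regular[OF that(1)] by auto
    have "distinct [ds \<Psi> p, dt \<Psi> p, c, d]"
      using that regular[OF that(1)] by auto
    from distinct_card[OF this] show "card {ds \<Psi> p, dt \<Psi> p, c, d} = 4" by simp
  qed
  show ?thesis
  proof
    assume "minimal_surface \<Psi> U"
    then obtain N1 N2 where N: "orthonormal_normal_frame \<Psi> U N1 N2"
      and H: "\<And>p. p \<in> U \<Longrightarrow> mean_curvature_vector \<Psi> N1 N2 p = 0"
      by (auto simp: minimal_surface_def)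
    show "\<forall>p\<in>U. M1 p \<bullet> Z p = 0 \<and> M2 p \<bullet> Z p = 0"
    proof
      fix p assume p: "p \<in> U"
      have NZ: "N1 p \<bullet> Z p = 0" "N2 p \<bullet> Z p = 0"
        using vanish[OF N p] H[OF p] by auto
      \<comment> \<open>Every normal vector is a combination of \<open>N1 p\<close> and
        \<open>N2 p\<close>; this applies to \<open>M1 p\<close> and \<open>M2 p\<close>.\<close>
      have "x \<bullet> Z p = 0" if "x \<bullet> ds \<Psi> p = 0" "x \<bullet> dt \<Psi> p = 0" for x
      proof -
        have "x = (x \<bullet> N1 p / (N1 p \<bullet> N1 p)) *\<^sub>R N1 p + (x \<bullet> N2 p / (N2 p \<bullet> N2 p)) *\<^sub>R N2 p"
          using N p tangentI[OF p]
          by (intro expand[OF p that]) (auto simp: orthonormal_normal_frame_def)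
        then have "x \<bullet> Z p = ((x \<bullet> N1 p / (N1 p \<bullet> N1 p)) *\<^sub>R N1 p +
            (x \<bullet> N2 p / (N2 p \<bullet> N2 p)) *\<^sub>R N2 p) \<bullet> Z p" by (rule arg_cong)
        also have "\<dots> = 0" by (simp add: inner_add_left NZ)
        finally show ?thesis .
      qed
      then show "M1 p \<bullet> Z p = 0 \<and> M2 p \<bullet> Z p = 0"
        using frame[OF p] by blast
    qed
  next
    assume MZ: "\<forall>p\<in>U. M1 p \<bullet> Z p = 0 \<and> M2 p \<bullet> Z p = 0"
    \<comment> \<open>The witness for the existential frame is obtained by normalising
      \<open>M1\<close> and \<open>M2\<close>.\<close>
    have N: "orthonormal_normal_frame \<Psi> U (\<lambda>p. sgn (M1 p)) (\<lambda>p. sgn (M2 p))"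
      unfolding orthonormal_normal_frame_def
    proof (intro conjI ballI)
      show "smooth_on (\<lambda>p. sgn (M1 p)) U" "smooth_on (\<lambda>p. sgn (M2 p)) U"
        using smooth frame(1) by (auto intro!: smooth_on_sgn[OF U])
    qed (use frame in \<open>auto simp: norm_sgn sgn_div_norm tangent inner_add_right\<close>)
    moreover have "mean_curvature_vector \<Psi> (\<lambda>p. sgn (M1 p)) (\<lambda>p. sgn (M2 p)) p = 0" if "p \<in> U" for p
      using vanish[OF N that] MZ that by (simp add: sgn_div_norm)
    ultimately show "minimal_surface \<Psi> U"
      unfolding minimal_surface_def by blast
  qed
qed

section \<open>The ternary product in an orthonormal frame\<close>

lemma vector_4 [simp]:
  "(vector [w, x, y, z] :: 'a::zero^4)$1 = w"
  "(vector [w, x, y, z] :: 'a::zero^4)$2 = x"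
  "(vector [w, x, y, z] :: 'a::zero^4)$3 = y"
  "(vector [w, x, y, z] :: 'a::zero^4)$4 = z"
  unfolding vector_def by simp_all

lemma det_4:
  "det (A :: 'a::comm_ring_1^4^4) =
    A$1$1 * (A$2$2 * A$3$3 * A$4$4 + A$2$3 * A$3$4 * A$4$2 + A$2$4 * A$3$2 * A$4$3
      - A$2$2 * A$3$4 * A$4$3 - A$2$3 * A$3$2 * A$4$4 - A$2$4 * A$3$3 * A$4$2)
    - A$1$2 * (A$2$1 * A$3$3 * A$4$4 + A$2$3 * A$3$4 * A$4$1 + A$2$4 * A$3$1 * A$4$3
      - A$2$1 * A$3$4 * A$4$3 - A$2$3 * A$3$1 * A$4$4 - A$2$4 * A$3$3 * A$4$1)
    + A$1$3 * (A$2$1 * A$3$2 * A$4$4 + A$2$2 * A$3$4 * A$4$1 + A$2$4 * A$3$1 * A$4$2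
      - A$2$1 * A$3$4 * A$4$2 - A$2$2 * A$3$1 * A$4$4 - A$2$4 * A$3$2 * A$4$1)
    - A$1$4 * (A$2$1 * A$3$2 * A$4$3 + A$2$2 * A$3$3 * A$4$1 + A$2$3 * A$3$1 * A$4$2
      - A$2$1 * A$3$3 * A$4$2 - A$2$2 * A$3$1 * A$4$3 - A$2$3 * A$3$2 * A$4$1)"
proof -
  have f1234: "finite {2::4, 3, 4}" "1 \<notin> {2::4, 3, 4}"
    by auto
  have f234: "finite {3::4, 4}" "2 \<notin> {3::4, 4}"
    by auto
  have f34: "finite {4::4}" "3 \<notin> {4::4}"
    by auto
  show ?thesis
    unfolding det_def UNIV_4
    unfolding sum_over_permutations_insert[OF f1234]
    unfolding sum_over_permutations_insert[OF f234]
    unfolding sum_over_permutations_insert[OF f34]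
    unfolding permutes_sing
    by (simp add: sign_swap_id permutation_swap_id permutation_compose sign_compose sign_id
        swap_id_eq algebra_simps)
qed

text \<open>The determinant is linear in its first row, and the components of
  \<open>triple_cross\<close> are its values when that row is a basis vector.\<close>

lemma triple_cross_inner: "triple_cross x y z \<bullet> w = det (vector [w, x, y, z] :: real^4^4)"
  by (simp add: triple_cross_def inner_vec_def sum_4 det_4 axis_def algebra_simps)

text \<open>A positively oriented orthonormal frame has determinant 1, so the product may be
  computed in coordinates as for the standard basis. The component \<open>c\<close> along
  \<open>T\<close> disappears because \<open>T\<close> is already a factor; what remains is minus
  the usual cross product of the vectors \<open>k\<close> and \<open>l\<close>.\<close>

lemma triple_cross_frame:
  fixes T P1 P2 P3 :: "real^4"
  defines "M \<equiv> vector [T, P1, P2, P3] :: real^4^4"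
  assumes orth: "orthogonal_matrix M" and pos: "det M > 0"
  shows "triple_cross T (k1 *\<^sub>R P1 + k2 *\<^sub>R P2 + k3 *\<^sub>R P3)
      (c *\<^sub>R T + l1 *\<^sub>R P1 + l2 *\<^sub>R P2 + l3 *\<^sub>R P3) =
    (k3 * l2 - k2 * l3) *\<^sub>R P1 + (k1 * l3 - k3 * l1) *\<^sub>R P2 + (k2 * l1 - k1 * l2) *\<^sub>R P3"
    (is "triple_cross T ?K ?L = ?R")
proof -
  have det_M: "det M = 1"
    using det_orthogonal_matrix[OF orth] pos by auto
  have on: "norm (M $ i) = 1" "i \<noteq> j \<Longrightarrow> M $ i \<bullet> M $ j = 0" for i j
    using orth unfolding orthogonal_matrix_orthonormal_rows orthogonal_def
    by (auto simp: row_def)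
  have on': "T \<bullet> T = 1" "P1 \<bullet> P1 = 1" "P2 \<bullet> P2 = 1" "P3 \<bullet> P3 = 1"
    "T \<bullet> P1 = 0" "T \<bullet> P2 = 0" "T \<bullet> P3 = 0" "P1 \<bullet> P2 = 0" "P1 \<bullet> P3 = 0" "P2 \<bullet> P3 = 0"
    "P1 \<bullet> T = 0" "P2 \<bullet> T = 0" "P3 \<bullet> T = 0" "P2 \<bullet> P1 = 0" "P3 \<bullet> P1 = 0" "P3 \<bullet> P2 = 0"
    using on(1)[of 1] on(1)[of 2] on(1)[of 3] on(1)[of 4]
      on(2)[of 1 2] on(2)[of 1 3] on(2)[of 1 4] on(2)[of 2 3] on(2)[of 2 4] on(2)[of 3 4]
    by (simp_all add: M_def norm_eq_1 inner_commute)
  have eq: "triple_cross T ?K ?L \<bullet> (w0 *\<^sub>R T + w1 *\<^sub>R P1 + w2 *\<^sub>R P2 + w3 *\<^sub>R P3) =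
      ?R \<bullet> (w0 *\<^sub>R T + w1 *\<^sub>R P1 + w2 *\<^sub>R P2 + w3 *\<^sub>R P3)" for w0 w1 w2 w3
  proof -
    \<comment> \<open>The rows of \<open>?C\<close> are the frame coordinates of the four vectors,
      so the determinant factors as that of \<open>?C\<close> times
      \<open>det M = 1\<close>.\<close>
    let ?C = "vector [vector [w0, w1, w2, w3], vector [1, 0, 0, 0], vector [0, k1, k2, k3],
      vector [c, l1, l2, l3]] :: real^4^4"
    have "(vector [w0 *\<^sub>R T + w1 *\<^sub>R P1 + w2 *\<^sub>R P2 + w3 *\<^sub>R P3, T, ?K, ?L] :: real^4^4) = ?C ** M"
      by (simp add: vec_eq_iff forall_4 matrix_matrix_mult_def sum_4 M_def)
    then have "triple_cross T ?K ?L \<bullet> (w0 *\<^sub>R T + w1 *\<^sub>R P1 + w2 *\<^sub>R P2 + w3 *\<^sub>R P3) = det ?C"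
      by (simp add: triple_cross_inner det_mul det_M)
    also have "\<dots> = ?R \<bullet> (w0 *\<^sub>R T + w1 *\<^sub>R P1 + w2 *\<^sub>R P2 + w3 *\<^sub>R P3)"
      by (simp add: det_4 inner_add_left inner_add_right on' algebra_simps)
    finally show ?thesis .
  qed
  \<comment> \<open>Testing with each frame vector shows that the difference is orthogonal to all
    rows of the invertible matrix \<open>M\<close>.\<close>
  have "(triple_cross T ?K ?L - ?R) \<bullet> M $ i = 0" for i
    using eq[of 1 0 0 0] eq[of 0 1 0 0] eq[of 0 0 1 0] eq[of 0 0 0 1] exhaust_4[of i]
    by (auto simp: M_def inner_diff_left)
  then have "M *v (triple_cross T ?K ?L - ?R) = 0"
    by (simp add: vec_eq_iff matrix_vector_mul_component inner_commute)
  then have "triple_cross T ?K ?L - ?R = transpose M *v 0"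
    using orth by (metis matrix_vector_mul_assoc matrix_vector_mul_lid orthogonal_matrix)
  then show ?thesis by simp
qed

section \<open>The soliton surface\<close>

text \<open>The values lie in an arbitrary normed space, so that the rule covers both combinations
  of frame fields and, with real values, the scalar identity \<open>k_PRS\<close>.\<close>

lemma partials_frame_combination:
  fixes a b c :: "real \<times> real \<Rightarrow> real" and X Y Z :: "real \<times> real \<Rightarrow> 'a::real_normed_vector"
  assumes "a differentiable at p" "b differentiable at p" "c differentiable at p"
    and "X differentiable at p" "Y differentiable at p" "Z differentiable at p"
  shows "ds (\<lambda>q. a q *\<^sub>R X q + b q *\<^sub>R Y q + c q *\<^sub>R Z q) p =
      a p *\<^sub>R ds X p + ds a p *\<^sub>R X p + (b p *\<^sub>R ds Y p + ds b p *\<^sub>R Y p) +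
      (c p *\<^sub>R ds Z p + ds c p *\<^sub>R Z p)"
    and "dt (\<lambda>q. a q *\<^sub>R X q + b q *\<^sub>R Y q + c q *\<^sub>R Z q) p =
      a p *\<^sub>R dt X p + dt a p *\<^sub>R X p + (b p *\<^sub>R dt Y p + dt b p *\<^sub>R Y p) +
      (c p *\<^sub>R dt Z p + dt c p *\<^sub>R Z p)"
proof -
  have "(\<lambda>q. a q *\<^sub>R X q) differentiable at p" "(\<lambda>q. b q *\<^sub>R Y q) differentiable at p"
    "(\<lambda>q. c q *\<^sub>R Z q) differentiable at p"
    using assms by (auto intro: differentiable_scaleR)
  then show "ds (\<lambda>q. a q *\<^sub>R X q + b q *\<^sub>R Y q + c q *\<^sub>R Z q) p =
      a p *\<^sub>R ds X p + ds a p *\<^sub>R X p + (b p *\<^sub>R ds Y p + ds b p *\<^sub>R Y p) +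
      (c p *\<^sub>R ds Z p + ds c p *\<^sub>R Z p)"
    and "dt (\<lambda>q. a q *\<^sub>R X q + b q *\<^sub>R Y q + c q *\<^sub>R Z q) p =
      a p *\<^sub>R dt X p + dt a p *\<^sub>R X p + (b p *\<^sub>R dt Y p + dt b p *\<^sub>R Y p) +
      (c p *\<^sub>R dt Z p + dt c p *\<^sub>R Z p)"
    by (simp_all add: partials_add partials_scaleR assms differentiable_add)
qed

theorem theorem6:
  fixes I J :: "real set"
    and \<Psi> T P1 P2 P3 :: "real \<times> real \<Rightarrow> real^4"
    and k1 k2 k3 :: "real \<times> real \<Rightarrow> real"
  assumes "open_interval I" and "open_interval J"
    and "smooth_on \<Psi> (I \<times> J)"
    and "\<forall>p\<in>I \<times> J. norm (ds \<Psi> p) = 1"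
    and "\<forall>p\<in>I \<times> J. dt \<Psi> p = triple_cross (ds \<Psi> p) (ds (ds \<Psi>) p) (ds (ds (ds \<Psi>)) p)"
    and "parallel_transport_frame \<Psi> (I \<times> J) T P1 P2 P3 k1 k2 k3"
    and "(\<exists>p\<in>I \<times> J. k1 p \<noteq> 0) \<and> (\<exists>p\<in>I \<times> J. k2 p \<noteq> 0) \<or>
         (\<exists>p\<in>I \<times> J. k1 p \<noteq> 0) \<and> (\<exists>p\<in>I \<times> J. k3 p \<noteq> 0) \<or>
         (\<exists>p\<in>I \<times> J. k2 p \<noteq> 0) \<and> (\<exists>p\<in>I \<times> J. k3 p \<noteq> 0)"
    and "\<forall>p\<in>I \<times> J. \<not> (curv_P k2 k3 p = 0 \<and> curv_R k1 k3 p = 0 \<and> curv_S k1 k2 p = 0)"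
  shows "minimal_surface \<Psi> (I \<times> J) \<longleftrightarrow>
    (\<forall>p\<in>I \<times> J. curv_B k1 k2 k3 P1 P2 P3 p = 0) \<and>
    (\<forall>p\<in>I \<times> J. (curv_Q k1 k2 k3 p)\<^sup>2 * (curv_W k1 k2 k3 p)\<^sup>2 + curv_A k1 k2 k3 P1 P2 P3 p = 0)"
proof -
  define U where "U = I \<times> J"
  define P R S where "P = curv_P k2 k3" and "R = curv_R k1 k3" and "S = curv_S k1 k2"
  have U: "open U"
    using assms(1,2) by (auto simp: U_def open_interval_def open_Times)
  have smooth: "smooth_on \<Psi> U" "smooth_on T U" "smooth_on P1 U" "smooth_on P2 U" "smooth_on P3 U"
    using assms(3,6) by (simp_all add: parallel_transport_frame_def U_def)
  note diff = smooth_on_differentiable[OF U]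
  have on: "T p \<bullet> T p = 1" "P1 p \<bullet> P1 p = 1" "P2 p \<bullet> P2 p = 1" "P3 p \<bullet> P3 p = 1"
      "T p \<bullet> P1 p = 0" "T p \<bullet> P2 p = 0" "T p \<bullet> P3 p = 0"
      "P1 p \<bullet> P2 p = 0" "P1 p \<bullet> P3 p = 0" "P2 p \<bullet> P3 p = 0"
      "P1 p \<bullet> T p = 0" "P2 p \<bullet> T p = 0" "P3 p \<bullet> T p = 0"
      "P2 p \<bullet> P1 p = 0" "P3 p \<bullet> P1 p = 0" "P3 p \<bullet> P2 p = 0"
    and det: "det (vector [T p, P1 p, P2 p, P3 p] :: real^4^4) > 0"
    and T: "ds \<Psi> p = T p"
    and ds_T: "ds T p = k1 p *\<^sub>R P1 p + k2 p *\<^sub>R P2 p + k3 p *\<^sub>R P3 p"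
    and ds_P: "ds P1 p = - (k1 p *\<^sub>R T p)" "ds P2 p = - (k2 p *\<^sub>R T p)" "ds P3 p = - (k3 p *\<^sub>R T p)"
    if "p \<in> U" for p
    using assms(6) that
    by (auto simp: parallel_transport_frame_def U_def norm_eq_1 inner_commute)
  \<comment> \<open>Smoothness of the curvature functions follows from that of the frame, since
    \<open>k1\<close>, \<open>k2\<close>, \<open>k3\<close> are the components of T_s along
    \<open>P1\<close>, \<open>P2\<close>, \<open>P3\<close>.\<close>
  have smooth_k: "smooth_on k1 U" "smooth_on k2 U" "smooth_on k3 U"
  proof -
    have "smooth_on (\<lambda>p. ds T p \<bullet> X p) U" if "smooth_on X U" for X
      by (rule smooth_on_inner[OF U smooth_on_partials(1)[OF smooth(2)] that])
    from smooth_on_cong[OF U _ this[OF smooth(3)]] smooth_on_cong[OF U _ this[OF smooth(4)]]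
      smooth_on_cong[OF U _ this[OF smooth(5)]]
    show "smooth_on k1 U" "smooth_on k2 U" "smooth_on k3 U"
      using ds_T on by (simp_all add: inner_add_left)
  qed
  note diff_P = smooth(3-5)[THEN diff] and diff_k = smooth_k[THEN diff]
  note smooth_dk = smooth_k[THEN smooth_on_partials(1)]
  have smooth_PRS: "smooth_on P U" "smooth_on R U" "smooth_on S U"
    unfolding P_def R_def S_def curv_P_def curv_R_def curv_S_def
    by (intro smooth_on_minus smooth_on_mult U smooth_k smooth_dk)+
  note diff_PRS = smooth_PRS[THEN diff]
  have PRS: "P p \<noteq> 0 \<or> R p \<noteq> 0 \<or> S p \<noteq> 0" if "p \<in> U" for p
    using assms(8) that by (auto simp: P_def R_def S_def U_def)
  \<comment> \<open>(P, R, S) is minus the cross product of (k1, k2, k3) with its s-derivative,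
    hence orthogonal to (k1, k2, k3).\<close>
  have k_PRS: "k1 p * P p + k2 p * R p + k3 p * S p = 0" for p
    by (simp add: P_def R_def S_def curv_P_def curv_R_def curv_S_def algebra_simps)
  have ds_ds: "ds (ds \<Psi>) p = ds T p" if "p \<in> U" for p
    by (rule partials_cong(1)[OF U that T])
  \<comment> \<open>The frame equations give \<Psi>_sss = -Q^2 T plus the sum of the (k_i)_s P_i;
    the T-part drops out by \<open>triple_cross_frame\<close>.\<close>
  have dt_\<Psi>: "dt \<Psi> p = P p *\<^sub>R P1 p + R p *\<^sub>R P2 p + S p *\<^sub>R P3 p" if p: "p \<in> U" for p
  proof -
    have "ds (ds (ds \<Psi>)) p = ds (\<lambda>q. k1 q *\<^sub>R P1 q + k2 q *\<^sub>R P2 q + k3 q *\<^sub>R P3 q) p"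
      by (rule partials_cong(1)[OF U p]) (simp add: ds_ds ds_T)
    also have "\<dots> = (- ((k1 p)\<^sup>2 + (k2 p)\<^sup>2 + (k3 p)\<^sup>2)) *\<^sub>R T p +
        ds k1 p *\<^sub>R P1 p + ds k2 p *\<^sub>R P2 p + ds k3 p *\<^sub>R P3 p"
      unfolding partials_frame_combination(1)[OF diff_k[OF p] diff_P[OF p]]
      by (simp add: ds_P p algebra_simps power2_eq_square)
    finally have sss: "ds (ds (ds \<Psi>)) p = \<dots>" .
    have "\<forall>i. norm ((vector [T p, P1 p, P2 p, P3 p] :: real^4^4) $ i) = 1"
      "\<forall>i j. i \<noteq> j \<longrightarrow> orthogonal ((vector [T p, P1 p, P2 p, P3 p] :: real^4^4) $ i)
        ((vector [T p, P1 p, P2 p, P3 p] :: real^4^4) $ j)"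
      using on[OF p] by (simp_all add: forall_4 norm_eq_1 orthogonal_def)
    then have "orthogonal_matrix (vector [T p, P1 p, P2 p, P3 p] :: real^4^4)"
      by (simp add: orthogonal_matrix_orthonormal_rows row_def)
    note cross = triple_cross_frame[OF this det[OF p]]
    have "dt \<Psi> p = triple_cross (ds \<Psi> p) (ds (ds \<Psi>) p) (ds (ds (ds \<Psi>)) p)"
      using assms(5) p unfolding U_def by blast
    then show ?thesis
      using p by (simp add: T ds_ds ds_T sss cross P_def R_def S_def curv_P_def curv_R_def curv_S_def)
  qed
  (* K \<times> V in the frame P1, P2, P3 *)
  define M where "M p = (k2 p * S p - k3 p * R p) *\<^sub>R P1 p + (k3 p * P p - k1 p * S p) *\<^sub>R P2 p +
    (k1 p * R p - k2 p * P p) *\<^sub>R P3 p" for p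
  \<comment> \<open>Lagrange's identity for the cross product; its mixed term vanishes by
    \<open>k_PRS\<close>. It will show that \<open>M\<close> has no zeros.\<close>
  have M_M: "M p \<bullet> M p = (ds T p \<bullet> ds T p) * (dt \<Psi> p \<bullet> dt \<Psi> p)" if "p \<in> U" for p
  proof -
    have "(ds T p \<bullet> ds T p) * (dt \<Psi> p \<bullet> dt \<Psi> p) =
        M p \<bullet> M p + (k1 p * P p + k2 p * R p + k3 p * S p)\<^sup>2"
      using that by (simp add: M_def ds_T dt_\<Psi> inner_add_left inner_add_right on
          algebra_simps power2_eq_square)
    then show ?thesis by (simp add: k_PRS)
  qed
  have W: "dt \<Psi> p \<bullet> dt \<Psi> p = (curv_W k1 k2 k3 p)\<^sup>2"
    and Q: "ds T p \<bullet> ds T p = (curv_Q k1 k2 k3 p)\<^sup>2" if "p \<in> U" for p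
    using that by (simp_all add: ds_T dt_\<Psi> inner_add_left inner_add_right on curv_W_def curv_Q_def
        P_def R_def S_def power2_eq_square)
  have W_nz: "(curv_W k1 k2 k3 p)\<^sup>2 > 0" if "p \<in> U" for p
  proof -
    have "(P p)\<^sup>2 > 0 \<or> (R p)\<^sup>2 > 0 \<or> (S p)\<^sup>2 > 0"
      using PRS[OF that] by simp
    then have "(P p)\<^sup>2 + (R p)\<^sup>2 + (S p)\<^sup>2 > 0"
      using zero_le_power2[of "P p"] zero_le_power2[of "R p"] zero_le_power2[of "S p"] by linarith
    then show ?thesis by (simp add: curv_W_def P_def R_def S_def)
  qed
  \<comment> \<open>The orthogonal normal fields are \<open>ds T\<close>, which is K, and
    \<open>M\<close>. Neither is normalised, which keeps the later expressions polynomial.\<close>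
  have minimal: "minimal_surface \<Psi> U \<longleftrightarrow>
    (\<forall>p\<in>U. ds T p \<bullet> (ds (ds \<Psi>) p /\<^sub>R (norm (ds \<Psi> p))\<^sup>2 + dt (dt \<Psi>) p /\<^sub>R (norm (dt \<Psi> p))\<^sup>2) = 0 \<and>
      M p \<bullet> (ds (ds \<Psi>) p /\<^sub>R (norm (ds \<Psi> p))\<^sup>2 + dt (dt \<Psi>) p /\<^sub>R (norm (dt \<Psi> p))\<^sup>2) = 0)"
  proof (rule minimal_surface_iff[OF U smooth(1) smooth_on_partials(1)[OF smooth(2)]])
    show "smooth_on M U"
      unfolding M_def
      by (intro smooth_on_add smooth_on_scaleR smooth_on_minus smooth_on_mult U smooth_k smooth_PRS smooth)
  next
    fix p assume p: "p \<in> U"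
    have "dt \<Psi> p \<bullet> dt \<Psi> p \<noteq> 0"
      using W[OF p] W_nz[OF p] by simp
    \<comment> \<open>If all three curvatures vanished at \<open>p\<close>, so would P, R and S,
      against the standing assumption.\<close>
    moreover have "ds T p \<noteq> 0"
    proof
      assume "ds T p = 0"
      then have "ds T p \<bullet> P1 p = 0" "ds T p \<bullet> P2 p = 0" "ds T p \<bullet> P3 p = 0" by simp_all
      then have "k1 p = 0" "k2 p = 0" "k3 p = 0"
        using p by (simp_all add: ds_T inner_add_left on)
      then show False
        using PRS[OF p] by (simp add: P_def R_def S_def curv_P_def curv_R_def curv_S_def)
    qed
    moreover from calculation have "M p \<bullet> M p \<noteq> 0"
      by (simp add: M_M p)
    moreover have "ds \<Psi> p \<noteq> 0"
      using on(1)[OF p] T[OF p] by auto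
    moreover have "ds \<Psi> p \<bullet> dt \<Psi> p = 0" "ds T p \<bullet> M p = 0"
      using p by (simp_all add: T ds_T dt_\<Psi> M_def inner_add_left inner_add_right on algebra_simps)
    ultimately show "ds \<Psi> p \<bullet> dt \<Psi> p = 0 \<and> ds \<Psi> p \<noteq> 0 \<and> dt \<Psi> p \<noteq> 0"
      "ds T p \<noteq> 0 \<and> M p \<noteq> 0 \<and> ds T p \<bullet> M p = 0"
      by auto
    show "ds T p \<bullet> ds \<Psi> p = 0 \<and> ds T p \<bullet> dt \<Psi> p = 0"
      using p k_PRS[of p]
      by (simp add: T ds_T dt_\<Psi> inner_add_left inner_add_right on mult.commute)
    show "M p \<bullet> ds \<Psi> p = 0 \<and> M p \<bullet> dt \<Psi> p = 0"
      using p by (simp add: T M_def dt_\<Psi> inner_add_left inner_add_right on algebra_simps)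
  qed
  have key: "ds T p \<bullet> dt (dt \<Psi>) p = curv_A k1 k2 k3 P1 P2 P3 p"
    "M p \<bullet> dt (dt \<Psi>) p = curv_B k1 k2 k3 P1 P2 P3 p" if p: "p \<in> U" for p
  proof -
    have skew: "X p \<bullet> dt Y p + dt X p \<bullet> Y p = 0"
      if "smooth_on X U" "smooth_on Y U" "\<And>q. q \<in> U \<Longrightarrow> X q \<bullet> Y q = c"
      for X Y :: "real \<times> real \<Rightarrow> real^4" and c
      using partials_cong(2)[OF U p that(3)] partials_inner(2)[OF diff diff, OF that(1) p that(2) p]
      by simp
    \<comment> \<open>The t-derivative of the orthonormality relations is skew. Components of the
      derivatives along \<open>T\<close> are irrelevant, as K and \<open>M\<close> are combinations
      of \<open>P1\<close>, \<open>P2\<close>, \<open>P3\<close>.\<close>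
    have dP: "P1 p \<bullet> dt P1 p = 0" "P2 p \<bullet> dt P2 p = 0" "P3 p \<bullet> dt P3 p = 0"
      "P2 p \<bullet> dt P1 p = fa23 P1 P2 p" "P1 p \<bullet> dt P2 p = - fa23 P1 P2 p"
      "P3 p \<bullet> dt P1 p = fa24 P1 P3 p" "P1 p \<bullet> dt P3 p = - fa24 P1 P3 p"
      "P3 p \<bullet> dt P2 p = fa34 P2 P3 p" "P2 p \<bullet> dt P3 p = - fa34 P2 P3 p"
      using skew[OF smooth(3,3) on(2)] skew[OF smooth(4,4) on(3)] skew[OF smooth(5,5) on(4)]
        skew[OF smooth(3,4) on(8)] skew[OF smooth(3,5) on(9)] skew[OF smooth(4,5) on(10)]
      by (simp_all add: fa23_def fa24_def fa34_def inner_commute)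
    have "dt (dt \<Psi>) p = dt (\<lambda>q. P q *\<^sub>R P1 q + R q *\<^sub>R P2 q + S q *\<^sub>R P3 q) p"
      by (rule partials_cong(2)[OF U p dt_\<Psi>])
    also have "\<dots> = P p *\<^sub>R dt P1 p + dt P p *\<^sub>R P1 p + (R p *\<^sub>R dt P2 p + dt R p *\<^sub>R P2 p) +
        (S p *\<^sub>R dt P3 p + dt S p *\<^sub>R P3 p)"
      by (rule partials_frame_combination(2)[OF diff_PRS[OF p] diff_P[OF p]])
    finally have tt: "dt (dt \<Psi>) p = \<dots>" .
    \<comment> \<open>Differentiating \<open>k_PRS\<close> in t trades k1 P_t + k2 R_t + k3 S_t for
      the terms with (k_i)_t in \<open>curv_A\<close>, which explains their minus signs.\<close>
    have "dt (\<lambda>q. k1 q *\<^sub>R P q + k2 q *\<^sub>R R q + k3 q *\<^sub>R S q) p = 0"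
      by (simp add: k_PRS)
    then have dk: "k1 p * dt P p + dt k1 p * P p + (k2 p * dt R p + dt k2 p * R p) +
        (k3 p * dt S p + dt k3 p * S p) = 0"
      unfolding partials_frame_combination(2)[OF diff_k[OF p] diff_PRS[OF p]] by simp
    show "ds T p \<bullet> dt (dt \<Psi>) p = curv_A k1 k2 k3 P1 P2 P3 p"
      using dk p
      by (simp add: ds_T tt curv_A_def inner_add_left inner_add_right on dP algebra_simps
          flip: P_def R_def S_def)
    have WW: "(curv_W k1 k2 k3 p)\<^sup>2 = P p * P p + R p * R p + S p * S p"
      unfolding W[OF p, symmetric] using p by (simp add: dt_\<Psi> inner_add_left inner_add_right on)
    have "M p \<bullet> dt (dt \<Psi>) p = (k2 p * S p - k3 p * R p) * (dt P p - R p * fa23 P1 P2 p - S p * fa24 P1 P3 p)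
      + (k3 p * P p - k1 p * S p) * (dt R p + P p * fa23 P1 P2 p - S p * fa34 P2 P3 p)
      + (k1 p * R p - k2 p * P p) * (dt S p + P p * fa24 P1 P3 p + R p * fa34 P2 P3 p)"
      using p by (simp add: M_def tt inner_add_left inner_add_right on dP algebra_simps)
    \<comment> \<open>By \<open>k_PRS\<close> the coefficients of \<open>fa23\<close>,
      \<open>fa24\<close>, \<open>fa34\<close> collapse to W^2 times k3, -k2, k1; the coefficient of
      \<open>fa23\<close>, for example, is k3 (P^2 + R^2) - S (k1 P + k2 R) = k3 W^2.\<close>
    also have "\<dots> = curv_B k1 k2 k3 P1 P2 P3 p"
      using k_PRS[of p] unfolding curv_B_def WW P_def[symmetric] R_def[symmetric] S_def[symmetric]
      by algebra
    finally show "M p \<bullet> dt (dt \<Psi>) p = curv_B k1 k2 k3 P1 P2 P3 p" .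
  qed
  \<comment> \<open>Since \<open>M\<close> is orthogonal to \<Psi>_ss, pairing with it leaves only
    the \<Psi>_tt term, while pairing with K also contributes Q^2.\<close>
  have "M p \<bullet> ds T p = 0" if "p \<in> U" for p
    using that by (simp add: M_def ds_T inner_add_left inner_add_right on algebra_simps)
  then have "minimal_surface \<Psi> U \<longleftrightarrow>
      (\<forall>p\<in>U. (curv_Q k1 k2 k3 p)\<^sup>2 + curv_A k1 k2 k3 P1 P2 P3 p / (curv_W k1 k2 k3 p)\<^sup>2 = 0 \<and>
        curv_B k1 k2 k3 P1 P2 P3 p / (curv_W k1 k2 k3 p)\<^sup>2 = 0)"
    unfolding minimal
    by (intro ball_cong) (simp_all add: ds_ds T on power2_norm_eq_inner inner_add_right key W Q
        divide_inverse mult.commute)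
  also have "\<dots> \<longleftrightarrow> (\<forall>p\<in>U. curv_B k1 k2 k3 P1 P2 P3 p = 0) \<and>
    (\<forall>p\<in>U. (curv_Q k1 k2 k3 p)\<^sup>2 * (curv_W k1 k2 k3 p)\<^sup>2 + curv_A k1 k2 k3 P1 P2 P3 p = 0)"
  proof -
    \<comment> \<open>Both denominators are W^2, which is positive on \<open>U\<close> and can be
      cleared.\<close>
    have "q + a / w = 0 \<longleftrightarrow> q * w + a = 0" "b / w = 0 \<longleftrightarrow> b = 0" if "w > 0" for q a b w :: real
      using that by (auto simp: field_simps)
    with W_nz show ?thesis by (metis (no_types, lifting))
  qed
  finally show ?thesis by (simp add: U_def)
qed

end
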